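(* Let $\bm{\psi}:\mathbb{R}^n\to\mathbb{R}$ be a convex function, let $\lambda>0$, let $l\in\{0,1,\ldots,n\}$, and let $\mathbf{u}^*=\sum_{i\in\mathbb{N}_l}u^*_{k_i}\mathbf{e}_{k_i}$ with $1\leq k_1<\cdots<k_l\leq n$ and $u^*_{k_i}\in\mathbb{R}\setminus\{0\}$ for $i\in\mathbb{N}_l$. Then the regularization problem $$\min\{\bm{\psi}(\mathbf{u})+\lambda\|\mathbf{u}\|_1:\mathbf{u}\in\mathbb{R}^n\}$$ has $\mathbf{u}^*$ as a solution if and only if there exists $\mathbf{y}=[y_j:j\in\mathbb{N}_n]\in\partial\bm{\psi}(\mathbf{u}^* )$ such that $$\lambda=-y_{k_i}\,\mathrm{sign}(u^*_{k_i}),\ i\in\mathbb{N}_l,\qquad\text{and}\qquad \lambda\geq|y_j|,\ j\in\mathbb{N}_n\setminus\{k_i:i\in\mathbb{N}_l\}.$$ In particular, if $\bm{\psi}$ is differentiable, then these conditions are equivalent to $$\lambda=-\bm{\psi}'_{k_i}(\mathbf{u}^* )\,\mathrm{sign}(u^*_{k_i}),\ i\in\mathbb{N}_l,\qquad\text{and}\qquad \lambda\geq|\bm{\psi}'_j(\mathbf{u}^* )|,\ j\in\mathbb{N}_n\setminus\{k_i:i\in\mathbb{N}_l\}.$$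
   Context: $\mathbb{N}_d:=\{1,\ldots,d\}$ and $\mathbb{N}_0:=\emptyset$. $\mathbf{e}_j$ is the $j$-th canonical basis vector of $\mathbb{R}^n$ (for $l=0$, $\mathbf{u}^*=\mathbf{0}$). $\partial\bm{\psi}$ denotes the subdifferential of $\bm{\psi}$, and $\bm{\psi}'_j$ the partial derivative of $\bm{\psi}$ with respect to the $j$-th variable. A solution of a minimization problem is a point at which the minimum is attained. *)

theory Defs
  imports "HOL-Analysis.Analysis"
begin

definition subdifferential :: "('a::real_inner \<Rightarrow> real) \<Rightarrow> 'a \<Rightarrow> 'a set" where
  "subdifferential f u = {y. \<forall>v. f v \<ge> f u + y \<bullet> (v - u)}"

definition norm_one :: "real ^ 'n \<Rightarrow> real" where
  "norm_one u = (\<Sum>j\<in>UNIV. \<bar>u $ j\<bar>)"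

text \<open>The derivative at \<open>u $ j\<close> of \<open>f\<close> as a function of its \<open>j\<close>-th variable, the others being
  fixed at their values in \<open>u\<close>. As usual for \<^const>\<open>deriv\<close>, the value is meaningful only where
  this derivative exists.\<close>

definition partial_deriv :: "(real ^ 'n \<Rightarrow> real) \<Rightarrow> 'n \<Rightarrow> real ^ 'n \<Rightarrow> real" where
  "partial_deriv f j u = deriv (\<lambda>t. f (\<chi> i. if i = j then t else u $ i)) (u $ j)"

end

(* Minimality of u for f + g says that the strict epigraph of f - f u is disjoint from the
   hypograph of g u - g. Both are convex, and a separating hyperplane cannot be vertical because f
   and g are finite everywhere; its slope y is a subgradient of f at u with - y a subgradient of g
   at u. For g = lam * norm_one the subgradients are determined coordinate by coordinate, and for
   differentiable f the only subgradient is the gradient. *)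

theory Submission
  imports Defs
begin

section \<open>Optimality for a sum of two convex functions\<close>

lemma arg_min_add_subdifferential_iff:
  fixes f g :: "'a::euclidean_space \<Rightarrow> real"
  assumes f: "convex_on UNIV f" and g: "convex_on UNIV g"
  shows "is_arg_min (\<lambda>v. f v + g v) (\<lambda>v. v \<in> UNIV) u \<longleftrightarrow>
    (\<exists>y\<in>subdifferential f u. - y \<in> subdifferential g u)"
proof
  assume "is_arg_min (\<lambda>v. f v + g v) (\<lambda>v. v \<in> UNIV) u"
  then have min: "f u + g u \<le> f v + g v" for v
    by (auto simp: is_arg_min_def not_less)
  \<comment> \<open>Only \<open>A\<close> is strict: the graphs of \<open>f - f u\<close> and
    \<open>g u - g\<close> touch at \<open>(u, 0)\<close>, so closing \<open>A\<close> would make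
    the sets meet there.\<close>
  define A where "A = {z :: 'a \<times> real. f (fst z) - f u < snd z}"
  define B where "B = {z :: 'a \<times> real. snd z \<le> g u - g (fst z)}"
  have conv_comb: "h (s *\<^sub>R x + t *\<^sub>R y) \<le> s * h x + t * h y"
    if "convex_on UNIV h" "0 \<le> s" "0 \<le> t" "s + t = 1" for h :: "'a \<Rightarrow> real" and s t x y
    using that unfolding convex_on_def by auto
  have "convex A"
  proof (rule convexI)
    fix x y :: "'a \<times> real" and s t :: real
    assume *: "x \<in> A" "y \<in> A" "0 \<le> s" "0 \<le> t" "s + t = 1"
    have "f (s *\<^sub>R fst x + t *\<^sub>R fst y) - f u \<le> s * (f (fst x) - f u) + t * (f (fst y) - f u)"
      using conv_comb[OF f *(3-5), of "fst x" "fst y"] *(5)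
      by (simp add: algebra_simps flip: distrib_right)
    also have "\<dots> < s * snd x + t * snd y"
    \<comment> \<open>If the weight \<open>s\<close> vanishes, \<open>x\<close> contributes no
      strictness; then \<open>t = 1\<close> and the strict inequality comes from
      \<open>y\<close>.\<close>
    proof (cases "s = 0")
      case True
      then show ?thesis using * by (simp add: A_def)
    next
      case False
      then show ?thesis
        using * by (intro add_less_le_mono mult_strict_left_mono mult_left_mono) (auto simp: A_def)
    qed
    finally show "s *\<^sub>R x + t *\<^sub>R y \<in> A"
      by (simp add: A_def)
  qed
  moreover have "convex B"
  proof (rule convexI)
    fix x y :: "'a \<times> real" and s t :: real
    assume *: "x \<in> B" "y \<in> B" "0 \<le> s" "0 \<le> t" "s + t = 1"
    have "s * snd x + t * snd y \<le> s * (g u - g (fst x)) + t * (g u - g (fst y))"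
      using * by (intro add_mono mult_left_mono) (auto simp: B_def)
    also have "\<dots> \<le> g u - g (s *\<^sub>R fst x + t *\<^sub>R fst y)"
      using conv_comb[OF g *(3-5), of "fst x" "fst y"] *(5)
      by (simp add: algebra_simps flip: distrib_right)
    finally show "s *\<^sub>R x + t *\<^sub>R y \<in> B"
      by (simp add: B_def)
  qed
  moreover have "(u, 1) \<in> A" "(u, 0) \<in> B"
    by (auto simp: A_def B_def)
  moreover have "B \<inter> A = {}"
  proof -
    have False if "z \<in> A" "z \<in> B" for z
      using that min[of "fst z"] by (simp add: A_def B_def)
    then show ?thesis by blast
  qed
  ultimately obtain ac b where ac: "ac \<noteq> 0" "\<And>z. z \<in> B \<Longrightarrow> ac \<bullet> z \<le> b" "\<And>z. z \<in> A \<Longrightarrow> b \<le> ac \<bullet> z"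
    using separating_hyperplane_sets[of B A] by blast
  obtain a c where [simp]: "ac = (a, c)" by (cases ac)
  have above: "b \<le> a \<bullet> v + c * r" if "f v - f u < r" for v r
    using ac(3)[of "(v, r)"] that by (simp add: A_def)
  have below: "a \<bullet> v + c * (g u - g v) \<le> b" for v
    using ac(2)[of "(v, g u - g v)"] by (simp add: B_def)
  \<comment> \<open>The graph of \<open>f - f u\<close> lies in the closure of \<open>A\<close>, so
    letting \<open>r\<close> decrease to \<open>f v - f u\<close> carries the bound over to the
    graph.\<close>
  have above_le: "b \<le> a \<bullet> v + c * (f v - f u)" for v
  proof (rule tendsto_lowerbound)
    show "((\<lambda>r. a \<bullet> v + c * r) \<longlongrightarrow> a \<bullet> v + c * (f v - f u)) (at_right (f v - f u))"
      by (intro tendsto_intros)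
    show "\<forall>\<^sub>F r in at_right (f v - f u). b \<le> a \<bullet> v + c * r"
      using above by (auto simp: eventually_at_filter)
  qed auto
  have b: "a \<bullet> u = b"
    using above_le[of u] below[of u] by simp
  have "c \<ge> 0"
    using above[of u 1] b by simp
  \<comment> \<open>For \<open>c = 0\<close> the two bounds would make \<open>a \<bullet> v\<close>
    equal to \<open>b\<close> for every \<open>v\<close>. Comparing \<open>v = u\<close> with
    \<open>v = u + a\<close> gives \<open>a \<bullet> a = 0\<close>, so the normal
    \<open>(a, c)\<close> would vanish.\<close>
  moreover have "c \<noteq> 0"
  proof
    assume "c = 0"
    then have "a \<bullet> (u + a) = b"
      using above_le[of "u + a"] below[of "u + a"] by simp
    then have "a = 0"
      using b by (simp add: inner_add_right)
    then show False
      using ac(1) \<open>c = 0\<close> by (simp add: zero_prod_def)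
  qed
  ultimately have c: "c > 0" by simp
  \<comment> \<open>With \<open>b = a \<bullet> u\<close>, dividing \<open>above_le\<close> and
    \<open>below\<close> by \<open>c\<close> yields the two subgradient inequalities with opposite
    slopes.\<close>
  have "- (a /\<^sub>R c) \<in> subdifferential f u"
    unfolding subdifferential_def
  proof safe
    fix v
    show "f u + - (a /\<^sub>R c) \<bullet> (v - u) \<le> f v"
      using above_le[of v] b c by (simp add: field_simps inner_diff_right)
  qed
  moreover have "a /\<^sub>R c \<in> subdifferential g u"
    unfolding subdifferential_def
  proof safe
    fix v
    show "g u + (a /\<^sub>R c) \<bullet> (v - u) \<le> g v"
      using below[of v] b c by (simp add: field_simps inner_diff_right)
  qed
  ultimately show "\<exists>y\<in>subdifferential f u. - y \<in> subdifferential g u"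
    by (intro bexI[of _ "- (a /\<^sub>R c)"]) simp_all
next
  assume "\<exists>y\<in>subdifferential f u. - y \<in> subdifferential g u"
  then obtain y where y: "\<And>v. f u + y \<bullet> (v - u) \<le> f v" "\<And>v. g u + - y \<bullet> (v - u) \<le> g v"
    by (auto simp: subdifferential_def)
  have "f u + g u \<le> f v + g v" for v
    using y(1)[of v] y(2)[of v] by simp
  then show "is_arg_min (\<lambda>v. f v + g v) (\<lambda>v. v \<in> UNIV) u"
    by (auto simp: is_arg_min_def not_less)
qed

section \<open>Convexity and subgradients of the 1-norm\<close>

lemma convex_on_norm_one: "convex_on UNIV (norm_one :: real ^ 'n \<Rightarrow> real)"
proof (rule convex_onI)
  fix t :: real and x y :: "real ^ 'n"
  assume t: "0 < t" "t < 1"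
  have "\<bar>(1 - t) * x $ j + t * y $ j\<bar> \<le> (1 - t) * \<bar>x $ j\<bar> + t * \<bar>y $ j\<bar>" for j
    using abs_triangle_ineq[of "(1 - t) * x $ j" "t * y $ j"] t by (simp add: abs_mult)
  then show "norm_one ((1 - t) *\<^sub>R x + t *\<^sub>R y) \<le> (1 - t) * norm_one x + t * norm_one y"
    by (simp add: norm_one_def sum_distrib_left sum_mono flip: sum.distrib)
qed simp

text \<open>The one-variable case: \<open>w\<close> is a subgradient of \<open>c\<close> times the
  absolute value at \<open>x\<close>. The kink at 0 admits all slopes between \<open>-c\<close> and
  \<open>c\<close>; elsewhere the function is locally linear and has a single slope.\<close>

lemma subdifferential_abs_iff:
  fixes c x w :: real
  assumes "0 \<le> c"
  shows "(\<forall>t. c * \<bar>x\<bar> + w * (t - x) \<le> c * \<bar>t\<bar>) \<longleftrightarrow>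
    (if x = 0 then \<bar>w\<bar> \<le> c else w = c * sgn x)"
proof (cases "x = 0")
  case True
  have "(\<forall>t. w * t \<le> c * \<bar>t\<bar>) \<longleftrightarrow> \<bar>w\<bar> \<le> c"
  proof
    assume *: "\<forall>t. w * t \<le> c * \<bar>t\<bar>"
    show "\<bar>w\<bar> \<le> c" using *[rule_format, of 1] *[rule_format, of "-1"] by simp
  next
    assume w: "\<bar>w\<bar> \<le> c"
    show "\<forall>t. w * t \<le> c * \<bar>t\<bar>"
    proof
      fix t
      have "w * t \<le> \<bar>w\<bar> * \<bar>t\<bar>" by (metis abs_ge_self abs_mult)
      also have "\<dots> \<le> c * \<bar>t\<bar>" using w by (simp add: mult_right_mono)
      finally show "w * t \<le> c * \<bar>t\<bar>" .
    qed
  qed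
  then show ?thesis using True by simp
next
  case False
  have "w = c * sgn x" if *: "\<forall>t. c * \<bar>x\<bar> + w * (t - x) \<le> c * \<bar>t\<bar>"
  proof -
    \<comment> \<open>Testing \<open>t = 0\<close> bounds \<open>w * x\<close> from below, and its
      mirror image \<open>t = 2 * x\<close> bounds it from above.\<close>
    have "w * x = c * \<bar>x\<bar>"
      using *[rule_format, of 0] *[rule_format, of "2 * x"] by (simp add: abs_mult)
    then have "w * x = (c * sgn x) * x" by (simp add: abs_sgn mult.commute mult.left_commute)
    then show ?thesis using False by simp
  qed
  moreover have "c * \<bar>x\<bar> + c * sgn x * (t - x) \<le> c * \<bar>t\<bar>" for t
  proof -
    have "\<bar>x\<bar> + sgn x * (t - x) \<le> \<bar>t\<bar>"
      using False by (auto simp: sgn_if)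
    then have "c * (\<bar>x\<bar> + sgn x * (t - x)) \<le> c * \<bar>t\<bar>"
      by (rule mult_left_mono) fact
    then show ?thesis by (simp add: algebra_simps)
  qed
  ultimately show ?thesis using False by auto
qed

text \<open>The 1-norm is separable, so the subgradient inequality splits into independent
  inequalities, one per coordinate.\<close>

lemma subdifferential_norm_one_iff:
  fixes u w :: "real ^ 'n"
  assumes "0 \<le> c"
  shows "w \<in> subdifferential (\<lambda>v. c * norm_one v) u \<longleftrightarrow>
    (\<forall>j. if u $ j = 0 then \<bar>w $ j\<bar> \<le> c else w $ j = c * sgn (u $ j))"
proof -
  have "w \<in> subdifferential (\<lambda>v. c * norm_one v) u \<longleftrightarrow>
    (\<forall>v. (\<Sum>j\<in>UNIV. c * \<bar>u $ j\<bar> + w $ j * (v $ j - u $ j)) \<le> (\<Sum>j\<in>UNIV. c * \<bar>v $ j\<bar>))"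
    by (simp add: subdifferential_def norm_one_def inner_vec_def sum_distrib_left sum.distrib)
  also have "\<dots> \<longleftrightarrow> (\<forall>j t. c * \<bar>u $ j\<bar> + w $ j * (t - u $ j) \<le> c * \<bar>t\<bar>)"
  proof safe
    fix j t
    assume *: "\<forall>v. (\<Sum>j\<in>UNIV. c * \<bar>u $ j\<bar> + w $ j * (v $ j - u $ j)) \<le> (\<Sum>j\<in>UNIV. c * \<bar>v $ j\<bar>)"
    \<comment> \<open>Only coordinate \<open>j\<close> moves, so all other summands agree on the two
      sides and cancel.\<close>
    define v where "v = (\<chi> i. if i = j then t else u $ i)"
    have "(\<Sum>i\<in>UNIV. c * \<bar>u $ i\<bar> + w $ i * (v $ i - u $ i)) \<le> (\<Sum>i\<in>UNIV. c * \<bar>v $ i\<bar>)"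
      using * by blast
    then show "c * \<bar>u $ j\<bar> + w $ j * (t - u $ j) \<le> c * \<bar>t\<bar>"
      by (simp add: sum.remove[of UNIV j] v_def)
  next
    fix v :: "real ^ 'n"
    assume "\<forall>j t. c * \<bar>u $ j\<bar> + w $ j * (t - u $ j) \<le> c * \<bar>t\<bar>"
    then show "(\<Sum>j\<in>UNIV. c * \<bar>u $ j\<bar> + w $ j * (v $ j - u $ j)) \<le> (\<Sum>j\<in>UNIV. c * \<bar>v $ j\<bar>)"
      by (intro sum_mono) simp
  qed
  finally show ?thesis
    by (simp add: subdifferential_abs_iff[OF assms])
qed

section \<open>Partial derivatives and subgradients of differentiable convex functions\<close>

lemma partial_deriv_eq:
  fixes f :: "real ^ 'n \<Rightarrow> real"
  assumes "(f has_derivative D) (at u)"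
  shows "partial_deriv f j u = D (axis j 1)"
proof -
  have line: "(\<chi> i. if i = j then t else u $ i) = u + (t - u $ j) *\<^sub>R axis j 1" for t
    by (simp add: vec_eq_iff axis_def)
  \<comment> \<open>The base point is written as the value of the line at \<open>t = u $ j\<close>,
    the form in which the chain rule applies.\<close>
  have "(f has_derivative D) (at (u + (u $ j - u $ j) *\<^sub>R axis j 1))"
    using assms by simp
  then have "((\<lambda>t. f (u + (t - u $ j) *\<^sub>R axis j 1)) has_derivative (\<lambda>h. D (h *\<^sub>R axis j 1))) (at (u $ j))"
    by (rule has_derivative_compose[rotated]) (auto intro!: derivative_eq_intros)
  then have "((\<lambda>t. f (u + (t - u $ j) *\<^sub>R axis j 1)) has_real_derivative D (axis j 1)) (at (u $ j))"
    by (simp add: has_field_derivative_def linear_scale[OF has_derivative_linear[OF assms]] mult_commute_abs)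
  then show ?thesis
    by (simp add: partial_deriv_def line DERIV_imp_deriv)
qed

text \<open>Restricting \<open>f\<close> to the line through \<open>u\<close> and \<open>v\<close>
  reduces the claim to the tangent inequality for a convex function of one real variable, taken at 0
  and evaluated at 1.\<close>

lemma convex_has_derivative_le:
  fixes f :: "'a::real_normed_vector \<Rightarrow> real"
  assumes f: "convex_on UNIV f" and D: "(f has_derivative D) (at u)"
  shows "f u + D (v - u) \<le> f v"
proof -
  let ?g = "\<lambda>t. f (u + t *\<^sub>R (v - u))"
  have "convex_on UNIV ?g"
  proof (rule convex_onI)
    fix t x y :: real
    assume "0 < t" "t < 1"
    moreover have "u + ((1 - t) * x + t * y) *\<^sub>R (v - u) =
        (1 - t) *\<^sub>R (u + x *\<^sub>R (v - u)) + t *\<^sub>R (u + y *\<^sub>R (v - u))"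
      by (simp add: algebra_simps)
    ultimately show "?g ((1 - t) *\<^sub>R x + t *\<^sub>R y) \<le> (1 - t) * ?g x + t * ?g y"
      using convex_onD[OF f, of t] by simp
  qed simp
  moreover have "(?g has_real_derivative D (v - u)) (at 0)"
  proof -
    have "(f has_derivative D) (at (u + 0 *\<^sub>R (v - u)))"
      using D by simp
    then have "(?g has_derivative (\<lambda>h. D (h *\<^sub>R (v - u)))) (at 0)"
      by (rule has_derivative_compose[rotated]) (auto intro!: derivative_eq_intros)
    then show ?thesis
      by (simp add: has_field_derivative_def linear_scale[OF has_derivative_linear[OF D]] mult_commute_abs)
  qed
  ultimately have "?g 1 - ?g 0 \<ge> D (v - u) * (1 - 0)"
    by (intro convex_on_imp_above_tangent[where A = UNIV]) auto
  then show ?thesis by simp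
qed

text \<open>If \<open>y\<close> is a subgradient, then \<open>f v - y \<bullet> v\<close> is minimal
  at \<open>v = u\<close>, so its derivative vanishes there and \<open>y\<close> is the gradient.
  Conversely, the tangent inequality makes the gradient a subgradient.\<close>

lemma subdifferential_differentiable:
  fixes f :: "real ^ 'n \<Rightarrow> real"
  assumes f: "convex_on UNIV f" and "f differentiable at u"
  shows "subdifferential f u = {\<chi> j. partial_deriv f j u}"
proof -
  obtain D where D: "(f has_derivative D) (at u)"
    using assms(2) by (auto simp: differentiable_def)
  have grad: "(\<chi> j. partial_deriv f j u) \<bullet> h = D h" for h
  proof -
    have "D h = D (\<Sum>j\<in>UNIV. (h $ j) *\<^sub>R axis j 1)"
      by (simp add: basis_expansion flip: scalar_mult_eq_scaleR)
    also have "\<dots> = (\<Sum>j\<in>UNIV. h $ j * D (axis j 1))"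
      using has_derivative_linear[OF D] by (simp add: linear_sum linear_scale)
    finally show ?thesis
      by (simp add: partial_deriv_eq[OF D] inner_vec_def mult.commute)
  qed
  have "y = (\<chi> j. partial_deriv f j u)" if "y \<in> subdifferential f u" for y
  proof -
    have le: "f u - y \<bullet> u \<le> f v - y \<bullet> v" for v
      using that by (simp add: subdifferential_def inner_diff_right algebra_simps)
    have "((\<lambda>v. f v - y \<bullet> v) has_derivative (\<lambda>h. D h - y \<bullet> h)) (at u)"
      by (intro derivative_intros D)
    then have "(\<lambda>h. D h - y \<bullet> h) = (\<lambda>h. 0)"
      by (rule differential_zero_maxmin[OF UNIV_I open_UNIV]) (use le in blast)
    then have "y \<bullet> axis j 1 = (\<chi> j. partial_deriv f j u) \<bullet> axis j 1" for j
      unfolding grad by (metis eq_iff_diff_eq_0)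
    then show ?thesis
      by (simp add: vec_eq_iff inner_axis)
  qed
  moreover have "(\<chi> j. partial_deriv f j u) \<in> subdifferential f u"
    using convex_has_derivative_le[OF f D] by (simp add: subdifferential_def grad)
  ultimately show ?thesis by blast
qed

section \<open>Optimality conditions for 1-norm regularization\<close>

theorem theorem3p9:
  fixes \<psi> :: "real ^ 'n::{finite,linorder} \<Rightarrow> real"
    and lam :: real
    and l :: nat
    and k :: "nat \<Rightarrow> 'n"
    and u :: "real ^ 'n::_"
  assumes "convex_on UNIV \<psi>"
    and "lam > 0"
    and "l \<le> CARD('n)"
    and "strict_mono_on {1..l} k"
    and "u = (\<Sum>i\<in>{1..l}. (u $ k i) *\<^sub>R axis (k i) 1)"
    and "\<And>i. i \<in> {1..l} \<Longrightarrow> u $ k i \<noteq> 0"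
  shows "(is_arg_min (\<lambda>v. \<psi> v + lam * norm_one v) (\<lambda>v. v \<in> UNIV) u \<longleftrightarrow>
            (\<exists>y\<in>subdifferential \<psi> u.
               (\<forall>i\<in>{1..l}. lam = - (y $ k i) * sgn (u $ k i)) \<and>
               (\<forall>j\<in>UNIV - k ` {1..l}. lam \<ge> \<bar>y $ j\<bar>)))
       \<and> (\<psi> differentiable_on UNIV \<longrightarrow>
            ((\<exists>y\<in>subdifferential \<psi> u.
                (\<forall>i\<in>{1..l}. lam = - (y $ k i) * sgn (u $ k i)) \<and>
                (\<forall>j\<in>UNIV - k ` {1..l}. lam \<ge> \<bar>y $ j\<bar>)) \<longleftrightarrow>
             (\<forall>i\<in>{1..l}. lam = - partial_deriv \<psi> (k i) u * sgn (u $ k i)) \<and>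
             (\<forall>j\<in>UNIV - k ` {1..l}. lam \<ge> \<bar>partial_deriv \<psi> j u\<bar>)))"
proof -
  \<comment> \<open>The support of \<open>u\<close> is exactly the image of \<open>k\<close>, so the
    case split on \<open>u $ j = 0\<close> becomes the split of the indices in the claim.\<close>
  have zero: "u $ j = 0 \<longleftrightarrow> j \<notin> k ` {1..l}" for j
  proof -
    have "u $ j = (\<Sum>i\<in>{1..l}. u $ k i * axis (k i) 1 $ j)"
      by (subst assms(5)) simp
    then have "u $ j = 0" if "j \<notin> k ` {1..l}"
      using that by (auto simp: axis_def intro!: sum.neutral)
    then show ?thesis using assms(6) by auto
  qed
  \<comment> \<open>For \<open>t \<noteq> 0\<close> the sign is its own inverse, so multiplying by
    it moves it to the other side.\<close>
  have sgn: "- x = lam * sgn t \<longleftrightarrow> lam = - x * sgn t" if "t \<noteq> 0" for x t :: real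
    using that by (auto simp: sgn_if)
  have cond: "- y \<in> subdifferential (\<lambda>v. lam * norm_one v) u \<longleftrightarrow>
      (\<forall>i\<in>{1..l}. lam = - (y $ k i) * sgn (u $ k i)) \<and> (\<forall>j\<in>UNIV - k ` {1..l}. lam \<ge> \<bar>y $ j\<bar>)" for y
  proof -
    have "- y \<in> subdifferential (\<lambda>v. lam * norm_one v) u \<longleftrightarrow>
        (\<forall>j\<in>k ` {1..l}. - y $ j = lam * sgn (u $ j)) \<and> (\<forall>j\<in>UNIV - k ` {1..l}. lam \<ge> \<bar>y $ j\<bar>)"
      using assms(2) by (auto simp: subdifferential_norm_one_iff zero)
    then show ?thesis
      using assms(6) by (simp add: sgn)
  qed
  have "convex_on UNIV (\<lambda>v :: real ^ 'n::_. lam * norm_one v)"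
    using assms(2) by (intro convex_on_cmul convex_on_norm_one) simp
  then have "is_arg_min (\<lambda>v. \<psi> v + lam * norm_one v) (\<lambda>v. v \<in> UNIV) u \<longleftrightarrow>
      (\<exists>y\<in>subdifferential \<psi> u. - y \<in> subdifferential (\<lambda>v. lam * norm_one v) u)"
    by (intro arg_min_add_subdifferential_iff assms(1))
  \<comment> \<open>In the differentiable case the existential ranges over a singleton, which turns
    \<open>y $ j\<close> into the partial derivative.\<close>
  moreover have "subdifferential \<psi> u = {\<chi> j. partial_deriv \<psi> j u}" if "\<psi> differentiable_on UNIV"
    using that by (intro subdifferential_differentiable assms(1)) (simp add: differentiable_on_def)
  ultimately show ?thesis
    unfolding cond by simp
qed

end
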